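(* Let $m\ge 3$, let $(X,\mathcal B)$ be a CURD (with $\lambda=1$) on $n$ varieties with partition $m^1 2^{\left(\frac{n-m}{2}\right)}$, and let $w$ be its number of parallel classes. Then each variety is in exactly $t$ blocks of size $m$, where $$t=\frac{n-w-1}{m-2}.$$
   Context: Let $X$ be a finite set of $n$ elements called varieties (or students). A block is a subset of $X$. A pairwise balanced design with index $\lambda$ is a pair $(X,\mathcal B)$, where $\mathcal B$ is a collection of blocks such that each pair of distinct varieties appears together in exactly $\lambda$ blocks. It is resolvable if $\mathcal B$ can be partitioned into sets, called parallel classes (or weeks), each of which contains each variety exactly once (i.e. the blocks of each parallel class partition $X$). It is a Class-Uniformly Resolvable Design (CURD) if moreover every parallel class has the same block sizes (with multiplicity). A CURD comes with this partition into parallel classes. A CURD on $n$ varieties has partition $m^1 2^{\left(\frac{n-m}{2}\right)}$ if each parallel class consists of exactly one block of size $m$ and exactly $\frac{n-m}{2}$ blocks of size $2$ (the case $n=m$, with no blocks of size 2, is allowed). Throughout, $\lambda=1$. *)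

theory Defs
  imports Complex_Main "HOL-Library.Multiset" "HOL-Library.Disjoint_Sets"
begin

text \<open>The blocks form a multiset, since for index greater than 1 a block may be repeated.\<close>

definition pairwise_balanced_design :: "'a set \<Rightarrow> 'a set multiset \<Rightarrow> nat \<Rightarrow> bool" where
  "pairwise_balanced_design X B l \<longleftrightarrow>
     finite X \<and> (\<forall>b\<in>#B. b \<subseteq> X) \<and>
     (\<forall>x\<in>X. \<forall>y\<in>X. x \<noteq> y \<longrightarrow> size {#b \<in># B. x \<in> b \<and> y \<in> b#} = l)"

text \<open>A parallel class is a set of blocks (the blocks of a partition are distinct), but the
  classes form a multiset: with repeated blocks the same class may be used more than once.
  The number of parallel classes is \<open>size P\<close>.\<close>

definition is_resolution :: "'a set \<Rightarrow> 'a set multiset \<Rightarrow> 'a set set multiset \<Rightarrow> bool" where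
  "is_resolution X B P \<longleftrightarrow>
     (\<forall>C\<in>#P. partition_on X C) \<and> (\<Sum>C\<in>#P. mset_set C) = B"

definition block_sizes :: "'a set set \<Rightarrow> nat multiset" where
  "block_sizes C = image_mset card (mset_set C)"

definition CURD :: "'a set \<Rightarrow> 'a set multiset \<Rightarrow> 'a set set multiset \<Rightarrow> nat \<Rightarrow> bool" where
  "CURD X B P l \<longleftrightarrow>
     pairwise_balanced_design X B l \<and> is_resolution X B P \<and>
     (\<forall>C\<in>#P. \<forall>D\<in>#P. block_sizes C = block_sizes D)"

text \<open>The conditions \<open>m \<le> card X\<close> and \<open>even (card X - m)\<close> make
  \<open>(card X - m) div 2\<close> the exact quotient.\<close>

definition has_partition_m1_2 :: "'a set \<Rightarrow> 'a set set multiset \<Rightarrow> nat \<Rightarrow> bool" where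
  "has_partition_m1_2 X P m \<longleftrightarrow>
     m \<le> card X \<and> even (card X - m) \<and>
     (\<forall>C\<in>#P. block_sizes C = add_mset m (replicate_mset ((card X - m) div 2) 2))"

end

theory Submission
  imports Defs
begin

text \<open>
  Fix a variety \<open>x\<close> lying in \<open>t\<close> blocks of size \<open>m\<close>. Every parallel class has exactly one block
  through \<open>x\<close>, so \<open>x\<close> lies in \<open>w - t\<close> blocks of size \<open>2\<close>. Each of the other \<open>n - 1\<close> varieties
  meets \<open>x\<close> in exactly one block, hence \<open>n - 1 = t (m - 1) + (w - t)\<close>.
\<close>

text \<open>Double counting of the pairs \<open>(b, y)\<close> with \<open>x\<close> and
  \<open>y\<close> in the block \<open>b\<close> and \<open>y\<close> different from
  \<open>x\<close>, first by blocks, then by varieties. The induction over the multiset counts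
  repeated blocks with multiplicity.\<close>

lemma sum_card_blocks_through:
  assumes "finite X" "x \<in> X" "\<forall>b\<in>#B. b \<subseteq> X"
  shows "(\<Sum>b\<in>#{#b \<in># B. x \<in> b#}. card b - 1)
    = (\<Sum>y\<in>X - {x}. size {#b \<in># B. x \<in> b \<and> y \<in> b#})"
  using assms(3)
proof (induction B)
  case empty
  then show ?case by simp
next
  case (add b B)
  then have b: "b \<subseteq> X" and
    IH: "(\<Sum>b\<in>#{#b \<in># B. x \<in> b#}. card b - 1)
      = (\<Sum>y\<in>X - {x}. size {#b \<in># B. x \<in> b \<and> y \<in> b#})"
    by auto
  show ?case
  proof (cases "x \<in> b")
    case True
    \<comment> \<open>The new block raises the count by one for exactly those \<open>y\<close> that
      lie in \<open>b\<close>.\<close>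
    have "(\<Sum>y\<in>X - {x}. size {#c \<in># add_mset b B. x \<in> c \<and> y \<in> c#})
      = (\<Sum>y\<in>X - {x}. (if y \<in> b then 1 else 0) + size {#c \<in># B. x \<in> c \<and> y \<in> c#})"
      using True by (intro sum.cong) auto
    also have "\<dots> = card ((X - {x}) \<inter> b) + (\<Sum>y\<in>X - {x}. size {#c \<in># B. x \<in> c \<and> y \<in> c#})"
      using assms(1) by (simp add: sum.distrib sum.If_cases Int_def)
    also have "(X - {x}) \<inter> b = b - {x}" using b by auto
    also have "card (b - {x}) = card b - 1"
      using True by simp
    finally show ?thesis using True IH by simp
  qed (use IH in simp)
qed

lemma pairwise_balanced_design_sum_card:
  assumes "pairwise_balanced_design X B l" "x \<in> X"
  shows "(\<Sum>b\<in>#{#b \<in># B. x \<in> b#}. card b - 1) = l * (card X - 1)"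
proof -
  have "(\<Sum>y\<in>X - {x}. size {#b \<in># B. x \<in> b \<and> y \<in> b#}) = (\<Sum>y\<in>X - {x}. l)"
    using assms by (intro sum.cong) (auto simp: pairwise_balanced_design_def)
  then show ?thesis
    using assms sum_card_blocks_through[of X x B]
    by (simp add: pairwise_balanced_design_def)
qed

lemma partition_on_size_block_through:
  assumes "finite X" "partition_on X C" "x \<in> X"
  shows "size {#b \<in># mset_set C. x \<in> b#} = 1"
proof -
  from assms(2,3) obtain b where "b \<in> C" "x \<in> b"
    by (auto simp: partition_on_def)
  then have "{c \<in> C. x \<in> c} = {b}"
    using assms(2) by (auto simp: partition_on_def disjoint_def)
  \<comment> \<open>Needed because \<open>mset_set\<close> of an infinite set is empty by
    convention.\<close>
  moreover have "finite C"
    using assms(1,2) by (rule finite_elements)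
  ultimately show ?thesis by (simp add: filter_mset_mset_set)
qed

text \<open>The multiset \<open>B\<close> is the sum of the classes, and each class contributes
  exactly one block through \<open>x\<close>.\<close>

lemma resolution_size_blocks_through:
  assumes "finite X" "is_resolution X B P" "x \<in> X"
  shows "size {#b \<in># B. x \<in> b#} = size P"
proof -
  have "\<forall>C\<in>#P. partition_on X C" and B: "B = (\<Sum>C\<in>#P. mset_set C)"
    using assms(2) by (auto simp: is_resolution_def)
  then have "size {#b \<in># (\<Sum>C\<in>#P. mset_set C). x \<in> b#} = size P"
  \<comment> \<open>The equation for \<open>B\<close> is among the chained facts; generalizing
    \<open>B\<close> lets the induction hypothesis apply to the sum over the smaller
    \<open>P\<close>.\<close>
  proof (induction P arbitrary: B)
    case (add C P)
    then show ?case
      using partition_on_size_block_through[OF assms(1) _ assms(3), of C] by simp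
  qed simp
  with B show ?thesis by simp
qed

lemma card_block_of_partition_m1_2:
  assumes "is_resolution X B P" "has_partition_m1_2 X P m" "b \<in># B"
  shows "card b = m \<or> card b = 2"
proof -
  obtain C where C: "C \<in># P" "b \<in># mset_set C"
    using assms(1,3) by (auto simp: is_resolution_def)
  then have "card b \<in># block_sizes C"
    by (simp add: block_sizes_def)
  then show ?thesis
    using C(1) assms(2) by (auto simp: has_partition_m1_2_def split: if_splits)
qed

text \<open>Every block contributes 1, and a block of size \<open>m\<close> contributes
  \<open>m - 2\<close> more. Counting this way avoids the truncated difference \<open>w - t\<close>
  in the later application.\<close>

lemma sum_card_two_sizes:
  assumes "m \<ge> 3" "\<forall>b\<in>#M. card b = m \<or> card b = 2"
  shows "(\<Sum>b\<in>#M. card b - 1) = size {#b \<in># M. card b = m#} * (m - 2) + size M"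
  using assms by (induction M) auto

theorem theorem2p2:
  fixes X :: "'a set" and B :: "'a set multiset" and P :: "'a set set multiset"
    and n m w :: nat
  assumes "m \<ge> 3"
    and "CURD X B P 1"
    and "card X = n"
    and "has_partition_m1_2 X P m"
    and "size P = w"
  shows "\<forall>x\<in>X. real (size {#b \<in># B. x \<in> b \<and> card b = m#})
           = (real n - real w - 1) / (real m - 2)"
proof
  fix x assume x: "x \<in> X"
  define t where "t = size {#b \<in># B. x \<in> b \<and> card b = m#}"
  have pbd: "pairwise_balanced_design X B 1" and res: "is_resolution X B P"
    using assms(2) by (auto simp: CURD_def)
  have fin: "finite X"
    using pbd by (simp add: pairwise_balanced_design_def)
  have "n - 1 = (\<Sum>b\<in>#{#b \<in># B. x \<in> b#}. card b - 1)"
    using pairwise_balanced_design_sum_card[OF pbd x] assms(3) by simp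
  also have "\<dots> = size {#b \<in># {#b \<in># B. x \<in> b#}. card b = m#} * (m - 2)
      + size {#b \<in># B. x \<in> b#}"
    using card_block_of_partition_m1_2[OF res assms(4)]
    by (intro sum_card_two_sizes[OF assms(1)]) auto
  also have "\<dots> = t * (m - 2) + w"
    using resolution_size_blocks_through[OF fin res x] assms(5)
    by (simp add: t_def filter_filter_mset conj_commute)
  finally have "n - 1 = t * (m - 2) + w" .
  \<comment> \<open>This makes the natural number subtraction \<open>n - 1\<close> exact.\<close>
  moreover have "n \<ge> 1"
    using fin x assms(3) by (auto simp: Suc_le_eq card_gt_0_iff)
  ultimately have "n = t * (m - 2) + w + 1" by linarith
  \<comment> \<open>Since \<open>m \<ge> 3\<close>, the difference \<open>m - 2\<close> carries over
    to the reals and is nonzero, so the division below is legitimate.\<close>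
  then have "real n = real t * (real m - 2) + real w + 1"
    using assms(1) by (simp add: of_nat_diff)
  then show "real (size {#b \<in># B. x \<in> b \<and> card b = m#})
      = (real n - real w - 1) / (real m - 2)"
    using assms(1) by (simp add: t_def field_simps)
qed

end
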